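(* Let $r\ge0$, let $X$ be a uniformly convex Banach space, let $\mathcal{I}$ be an ideal on $\mathbb{N}$, let $\{\omega_t\}_{t\in\mathbb{N}}$ be a weighted sequence, and let $x=\{x_t\}_{t\in\mathbb{N}}$ be a sequence in $X$. Then: (a1) If $(\omega_t,\mathcal{I})\text{-}\mathrm{LIM}^r x_t$ is a singleton and $\{\omega_t\}_{t\in\mathbb{N}}$ is $\mathcal{I}$-bounded, then $r=\tilde r(x)$. (a2) If $r=\tilde r(x)$ and $\mathcal{I}$ is a $P$-ideal, then $(\omega_t,\mathcal{I})\text{-}\mathrm{LIM}^r x_t$ is a singleton.
   Context: A sequence $\{\omega_t\}_{t\in\mathbb{N}}$ of real numbers is a weighted sequence if there is $\beta>0$ with $\omega_t>\beta$ for all $t\in\mathbb{N}$. An ideal on $\mathbb{N}$ is a family $\mathcal{I}\subseteq\mathcal{P}(\mathbb{N})$ with $\varnothing\in\mathcal{I}$, closed under finite unions and under taking subsets. A $P$-ideal is an ideal $\mathcal{I}$ such that for every sequence $\{A_t\}_{t\in\mathbb{N}}$ of sets in $\mathcal{I}$ there is $A\in\mathcal{I}$ with $A_t\setminus A$ finite for each $t\in\mathbb{N}$. A weighted sequence $\{\omega_t\}_{t\in\mathbb{N}}$ is $\mathcal{I}$-bounded if there is $\mu>0$ with $\{t\in\mathbb{N}:\omega_t>\mu\}\in\mathcal{I}$. For $r\ge0$, $(\omega_t,\mathcal{I})\text{-}\mathrm{LIM}^r x_t$ is the set of all $x_*\in X$ such that $\{t\in\mathbb{N}:\omega_t\|x_t-x_*\|>r+\varepsilon\}\in\mathcal{I}$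 for every $\varepsilon>0$. The minimal weighted ideal convergent degree of $x$ is $\tilde r(x)=\tilde r_{(\omega_t,\mathcal{I})}(x):=\inf\{r\in(0,\infty):(\omega_t,\mathcal{I})\text{-}\mathrm{LIM}^r x_t\ne\varnothing\}$. $X$ is uniformly convex if for each $\varepsilon\in(0,2]$ there is $\delta>0$ such that $\|\tfrac{x+y}{2}\|\le 1-\delta$ whenever $x,y\in X$, $\|x\|=\|y\|=1$ and $\|x-y\|\ge\varepsilon$.
   Formalization: Part (a1) additionally assumes X is not the zero space (otherwise r = 1 is a counterexample), and part (a2) additionally assumes the ideal is proper, i.e. does not contain ℕ (otherwise every limit set is X and the minimal degree is 0). *)

theory Defs
  imports Complex_Main "HOL-Library.Extended_Real"
begin

definition weighted_seq :: "(nat \<Rightarrow> real) \<Rightarrow> bool" where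
  "weighted_seq \<omega> \<longleftrightarrow> (\<exists>\<beta>>0. \<forall>t. \<omega> t > \<beta>)"

text \<open>Ideals need be neither proper nor admissible (contain all finite sets).\<close>

definition nat_ideal :: "nat set set \<Rightarrow> bool" where
  "nat_ideal I \<longleftrightarrow> {} \<in> I \<and> (\<forall>A\<in>I. \<forall>B\<in>I. A \<union> B \<in> I) \<and> (\<forall>A\<in>I. \<forall>B. B \<subseteq> A \<longrightarrow> B \<in> I)"

definition P_ideal :: "nat set set \<Rightarrow> bool" where
  "P_ideal I \<longleftrightarrow> nat_ideal I \<and>
     (\<forall>A :: nat \<Rightarrow> nat set. (\<forall>t. A t \<in> I) \<longrightarrow> (\<exists>B\<in>I. \<forall>t. finite (A t - B)))"

definition ideal_bounded :: "nat set set \<Rightarrow> (nat \<Rightarrow> real) \<Rightarrow> bool" where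
  "ideal_bounded I \<omega> \<longleftrightarrow> (\<exists>\<mu>>0. {t. \<omega> t > \<mu>} \<in> I)"

definition weighted_LIM ::
  "(nat \<Rightarrow> real) \<Rightarrow> nat set set \<Rightarrow> real \<Rightarrow> (nat \<Rightarrow> 'a::real_normed_vector) \<Rightarrow> 'a set" where
  "weighted_LIM \<omega> I r x =
     {p. \<forall>\<epsilon>>0. {t. \<omega> t * norm (x t - p) > r + \<epsilon>} \<in> I}"

text \<open>The infimum is taken in the extended reals, so that it is \<open>\<infinity>\<close> when no \<open>r\<close> qualifies;
  the real-valued \<open>Inf {}\<close> is an unspecified number.\<close>

definition min_degree ::
  "(nat \<Rightarrow> real) \<Rightarrow> nat set set \<Rightarrow> (nat \<Rightarrow> 'a::real_normed_vector) \<Rightarrow> ereal" where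
  "min_degree \<omega> I x = Inf (ereal ` {r. 0 < r \<and> weighted_LIM \<omega> I r x \<noteq> {}})"

definition uniformly_convex :: "'a::real_normed_vector itself \<Rightarrow> bool" where
  "uniformly_convex _ \<longleftrightarrow>
     (\<forall>\<epsilon>. 0 < \<epsilon> \<and> \<epsilon> \<le> 2 \<longrightarrow>
       (\<exists>\<delta>>0. \<forall>x y :: 'a. norm x = 1 \<and> norm y = 1 \<and> norm (x - y) \<ge> \<epsilon> \<longrightarrow>
          norm ((x + y) /\<^sub>R 2) \<le> 1 - \<delta>))"

end

theory Submission
  imports Defs
begin

text \<open>
  Write \<open>L r\<close> for the set \<open>weighted_LIM \<omega> I r x\<close> of \<open>r\<close>-limits; these sets grow with \<open>r\<close>, and the
  minimal degree is the threshold above which they are nonempty.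

  If the weights are at most \<open>\<mu>\<close> off a set of the ideal, moving an \<open>s\<close>-limit by \<open>d / \<mu>\<close> costs at most
  \<open>d\<close> in the degree (\<open>weighted_LIM_shift\<close>). So if \<open>L s\<close> is nonempty for some \<open>s < r\<close>, then \<open>L r\<close>
  contains a ball, and in a nonzero space a singleton \<open>L r\<close> forces \<open>r\<close> to be the minimal degree.

  Conversely, let \<open>r\<close> be the minimal degree. Uniform convexity makes the midpoint of two \<open>s\<close>-limits at
  distance at least \<open>e\<close> a limit of degree \<open>(1 - \<delta>) * s\<close>, where \<open>\<delta>\<close> can be the same for all \<open>s\<close> in a
  bounded range
  (\<open>midpoint_gains_degree\<close>). Hence the diameter of \<open>L s\<close> tends to \<open>0\<close> as \<open>s\<close> decreases to \<open>r\<close>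
  (\<open>small_diameter_near_min_degree\<close>), which gives uniqueness at once. For existence choose
  \<open>p n\<close> in \<open>L (r + 1 / (n + 1))\<close>; the sequence \<open>p\<close> is Cauchy. The obstacle is that \<open>L s\<close> need not be
  closed when the weights are unbounded. But two distinct \<open>s\<close>-limits already bound the weights: if
  \<open>\<omega> t * norm (x t - p)\<close> and \<open>\<omega> t * norm (x t - q)\<close> are both bounded, so is \<open>\<omega> t * norm (p - q)\<close>
  (\<open>two_limits_bound_weights\<close>). Therefore either \<open>p\<close> is constant and its value lies in \<open>L r\<close>, or the
  weights are bounded off a set of the ideal and the limit of \<open>p\<close> lies in \<open>L r\<close>.
\<close>

section \<open>Rough limits along an ideal\<close>

lemma weighted_LIM_iff:
  assumes "nat_ideal I"
  shows "p \<in> weighted_LIM \<omega> I r x \<longleftrightarrow>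
    (\<forall>\<epsilon>>0. \<exists>A\<in>I. \<forall>t. t \<notin> A \<longrightarrow> \<omega> t * norm (x t - p) \<le> r + \<epsilon>)"
proof
  assume "p \<in> weighted_LIM \<omega> I r x"
  then show "\<forall>\<epsilon>>0. \<exists>A\<in>I. \<forall>t. t \<notin> A \<longrightarrow> \<omega> t * norm (x t - p) \<le> r + \<epsilon>"
    unfolding weighted_LIM_def by (metis (no_types, lifting) mem_Collect_eq not_le)
next
  assume R: "\<forall>\<epsilon>>0. \<exists>A\<in>I. \<forall>t. t \<notin> A \<longrightarrow> \<omega> t * norm (x t - p) \<le> r + \<epsilon>"
  have "{t. \<omega> t * norm (x t - p) > r + \<epsilon>} \<in> I" if \<epsilon>: "\<epsilon> > 0" for \<epsilon>
  proof -
    obtain A where "A \<in> I" and A: "\<forall>t. t \<notin> A \<longrightarrow> \<omega> t * norm (x t - p) \<le> r + \<epsilon>"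
      using R \<epsilon> by blast
    moreover have "{t. \<omega> t * norm (x t - p) > r + \<epsilon>} \<subseteq> A"
      using A by force
    ultimately show ?thesis
      using assms unfolding nat_ideal_def by blast
  qed
  then show "p \<in> weighted_LIM \<omega> I r x"
    unfolding weighted_LIM_def by blast
qed

lemma weighted_LIM_two:
  assumes "nat_ideal I" "p \<in> weighted_LIM \<omega> I r x" "q \<in> weighted_LIM \<omega> I r x" "\<epsilon> > 0"
  obtains A where "A \<in> I"
    "\<And>t. t \<notin> A \<Longrightarrow> \<omega> t * norm (x t - p) \<le> r + \<epsilon>"
    "\<And>t. t \<notin> A \<Longrightarrow> \<omega> t * norm (x t - q) \<le> r + \<epsilon>"
proof -
  obtain A B where "A \<in> I" "B \<in> I"
    "\<forall>t. t \<notin> A \<longrightarrow> \<omega> t * norm (x t - p) \<le> r + \<epsilon>"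
    "\<forall>t. t \<notin> B \<longrightarrow> \<omega> t * norm (x t - q) \<le> r + \<epsilon>"
    using assms weighted_LIM_iff by metis
  moreover have "A \<union> B \<in> I"
    using assms(1) \<open>A \<in> I\<close> \<open>B \<in> I\<close> unfolding nat_ideal_def by blast
  ultimately show ?thesis
    by (intro that[of "A \<union> B"]) auto
qed

lemma weighted_LIM_mono:
  assumes "nat_ideal I" "r \<le> s"
  shows "weighted_LIM \<omega> I r x \<subseteq> weighted_LIM \<omega> I s x"
proof
  fix p assume "p \<in> weighted_LIM \<omega> I r x"
  then have "\<forall>\<epsilon>>0. \<exists>A\<in>I. \<forall>t. t \<notin> A \<longrightarrow> \<omega> t * norm (x t - p) \<le> r + \<epsilon>"
    by (simp add: weighted_LIM_iff[OF assms(1)])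
  then show "p \<in> weighted_LIM \<omega> I s x"
    unfolding weighted_LIM_iff[OF assms(1)] using assms(2)
    by (meson add_right_mono order_trans)
qed

lemma weighted_LIM_right_continuous:
  assumes "nat_ideal I" "\<And>s. s > r \<Longrightarrow> p \<in> weighted_LIM \<omega> I s x"
  shows "p \<in> weighted_LIM \<omega> I r x"
  unfolding weighted_LIM_iff[OF assms(1)]
proof (intro allI impI)
  fix \<epsilon> :: real assume "\<epsilon> > 0"
  then have "p \<in> weighted_LIM \<omega> I (r + \<epsilon> / 2) x" "\<epsilon> / 2 > 0"
    using assms(2) by auto
  then obtain A where "A \<in> I" "\<forall>t. t \<notin> A \<longrightarrow> \<omega> t * norm (x t - p) \<le> r + \<epsilon> / 2 + \<epsilon> / 2"
    unfolding weighted_LIM_iff[OF assms(1)] by blast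
  moreover have "r + \<epsilon> / 2 + \<epsilon> / 2 = r + \<epsilon>"
    by simp
  ultimately show "\<exists>A\<in>I. \<forall>t. t \<notin> A \<longrightarrow> \<omega> t * norm (x t - p) \<le> r + \<epsilon>"
    by metis
qed

text \<open>Off the exceptional set the weights amplify the displacement of \<open>p\<close> by at most \<open>\<mu>\<close>.\<close>

lemma weighted_LIM_shift:
  assumes I: "nat_ideal I" and pos: "\<And>t. \<omega> t > 0"
    and bd: "{t. \<omega> t > \<mu>} \<in> I"
    and p: "p \<in> weighted_LIM \<omega> I s x" and d: "\<mu> * norm (p - q) \<le> d"
  shows "q \<in> weighted_LIM \<omega> I (s + d) x"
  unfolding weighted_LIM_iff[OF I]
proof (intro allI impI)
  fix \<epsilon> :: real assume "\<epsilon> > 0"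
  then obtain A where A: "A \<in> I" "\<forall>t. t \<notin> A \<longrightarrow> \<omega> t * norm (x t - p) \<le> s + \<epsilon>"
    using p unfolding weighted_LIM_iff[OF I] by blast
  have "\<omega> t * norm (x t - q) \<le> s + d + \<epsilon>" if "t \<notin> A \<union> {t. \<omega> t > \<mu>}" for t
  proof -
    have "\<omega> t * norm (x t - q) \<le> \<omega> t * (norm (x t - p) + norm (p - q))"
      using pos[of t] norm_triangle_ineq[of "x t - p" "p - q"] by (intro mult_left_mono) auto
    also have "\<dots> = \<omega> t * norm (x t - p) + \<omega> t * norm (p - q)"
      by (simp add: algebra_simps)
    also have "\<dots> \<le> (s + \<epsilon>) + \<mu> * norm (p - q)"
      using A(2) that by (intro add_mono mult_right_mono) auto
    finally show ?thesis
      using d by simp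
  qed
  moreover have "A \<union> {t. \<omega> t > \<mu>} \<in> I"
    using I A(1) bd unfolding nat_ideal_def by blast
  ultimately show "\<exists>A\<in>I. \<forall>t. t \<notin> A \<longrightarrow> \<omega> t * norm (x t - q) \<le> s + d + \<epsilon>"
    by blast
qed

text \<open>By the triangle inequality \<open>\<omega> t * norm (p - q)\<close> is at most \<open>2 * (s + 1)\<close> off a set of the ideal.\<close>

lemma two_limits_bound_weights:
  assumes I: "nat_ideal I" and pos: "\<And>t. \<omega> t > 0" and s: "s \<ge> 0"
    and p: "p \<in> weighted_LIM \<omega> I s x" and q: "q \<in> weighted_LIM \<omega> I s x" and "p \<noteq> q"
  shows "ideal_bounded I \<omega>"
proof -
  obtain A where A: "A \<in> I" "\<And>t. t \<notin> A \<Longrightarrow> \<omega> t * norm (x t - p) \<le> s + 1"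
    "\<And>t. t \<notin> A \<Longrightarrow> \<omega> t * norm (x t - q) \<le> s + 1"
    using weighted_LIM_two[OF I p q, of 1] by auto
  let ?\<mu> = "2 * (s + 1) / norm (p - q)"
  have "\<omega> t \<le> ?\<mu>" if "t \<notin> A" for t
  proof -
    have "\<omega> t * norm (p - q) \<le> \<omega> t * (norm (x t - q) + norm (x t - p))"
      using pos[of t] norm_triangle_ineq4[of "x t - q" "x t - p"] by (intro mult_left_mono) auto
    also have "\<dots> \<le> 2 * (s + 1)"
      using A(2,3)[OF that] by (simp add: algebra_simps)
    finally show ?thesis
      using \<open>p \<noteq> q\<close> by (simp add: pos_le_divide_eq)
  qed
  then have "{t. \<omega> t > ?\<mu>} \<subseteq> A"
    by force
  then have "{t. \<omega> t > ?\<mu>} \<in> I"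
    using I A(1) unfolding nat_ideal_def by blast
  moreover have "?\<mu> > 0"
    using s \<open>p \<noteq> q\<close> by simp
  ultimately show ?thesis
    unfolding ideal_bounded_def by blast
qed

section \<open>The minimal degree as a threshold\<close>

lemma min_degree_le:
  assumes "s > 0" "p \<in> weighted_LIM \<omega> I s x"
  shows "min_degree \<omega> I x \<le> ereal s"
  unfolding min_degree_def using assms by (intro Inf_lower) auto

lemma weighted_LIM_nonempty_above:
  assumes "nat_ideal I" "min_degree \<omega> I x < ereal s"
  obtains s' p where "0 < s'" "s' < s" "p \<in> weighted_LIM \<omega> I s' x" "p \<in> weighted_LIM \<omega> I s x"
proof -
  obtain s' p where "0 < s'" "s' < s" "p \<in> weighted_LIM \<omega> I s' x"
    using assms(2) unfolding min_degree_def Inf_less_iff by auto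
  moreover from this have "p \<in> weighted_LIM \<omega> I s x"
    using weighted_LIM_mono[OF assms(1), of s' s] by auto
  ultimately show ?thesis
    using that by blast
qed

lemma min_degree_le_of_nonneg:
  assumes I: "nat_ideal I" and "r \<ge> 0" and p: "p \<in> weighted_LIM \<omega> I r x"
  shows "min_degree \<omega> I x \<le> ereal r"
proof (rule ereal_le_epsilon2)
  fix \<epsilon> :: real assume "\<epsilon> > 0"
  then have "min_degree \<omega> I x \<le> ereal (r + \<epsilon>)"
    using assms weighted_LIM_mono[OF I, of r "r + \<epsilon>"] by (intro min_degree_le) auto
  then show "min_degree \<omega> I x \<le> ereal r + ereal \<epsilon>"
    by simp
qed

text \<open>As the weights are bounded, a limit of degree less than \<open>r\<close> could be moved a little in the
  direction of \<open>v\<close> without leaving the set of \<open>r\<close>-limits.\<close>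

lemma singleton_imp_min_degree:
  fixes x :: "nat \<Rightarrow> 'a::real_normed_vector"
  assumes I: "nat_ideal I" and "r \<ge> 0" and pos: "\<And>t. \<omega> t > 0"
    and v: "(v::'a) \<noteq> 0" and sing: "is_singleton (weighted_LIM \<omega> I r x)"
    and bd: "ideal_bounded I \<omega>"
  shows "min_degree \<omega> I x = ereal r"
proof (rule antisym)
  obtain p where p: "weighted_LIM \<omega> I r x = {p}"
    using sing by (auto elim: is_singletonE)
  then show "min_degree \<omega> I x \<le> ereal r"
    using min_degree_le_of_nonneg[OF I \<open>r \<ge> 0\<close>] by auto
  show "ereal r \<le> min_degree \<omega> I x"
  proof (rule ccontr)
    assume "\<not> ereal r \<le> min_degree \<omega> I x"
    then obtain s where s: "s < r" "p \<in> weighted_LIM \<omega> I s x"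
      using weighted_LIM_nonempty_above[OF I, of \<omega> x r] p by force
    obtain \<mu> where \<mu>: "\<mu> > 0" "{t. \<omega> t > \<mu>} \<in> I"
      using bd unfolding ideal_bounded_def by auto
    let ?q = "p - ((r - s) / (\<mu> * norm v)) *\<^sub>R v"
    have "\<mu> * norm (p - ?q) \<le> r - s"
      using \<mu>(1) s(1) v by simp
    from weighted_LIM_shift[OF I pos \<mu>(2) s(2) this]
    have "?q \<in> weighted_LIM \<omega> I r x"
      by simp
    then have "?q = p"
      using p by simp
    then show False
      using \<mu>(1) s(1) v by simp
  qed
qed

section \<open>Midpoints in uniformly convex spaces\<close>

text \<open>The definition speaks of unit vectors. If \<open>u\<close> or \<open>v\<close> has norm at most \<open>1 - \<eta>\<close>, the midpoint is
  short for trivial reasons; otherwise normalising moves each vector by less than \<open>\<eta>\<close>, which is small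
  against both \<open>\<epsilon>\<close> and the modulus for unit vectors at distance \<open>\<epsilon> / 2\<close>.\<close>

lemma uniformly_convex_unit_ball:
  assumes uc: "uniformly_convex TYPE('a::real_normed_vector)" and "\<epsilon> > 0"
  obtains \<delta> where "0 < \<delta>" "\<delta> < 1"
    "\<And>u v :: 'a. norm u \<le> 1 \<Longrightarrow> norm v \<le> 1 \<Longrightarrow> norm (u - v) \<ge> \<epsilon> \<Longrightarrow>
       norm ((u + v) /\<^sub>R 2) \<le> 1 - \<delta>"
proof -
  define e where "e = min \<epsilon> 2"
  have e: "0 < e" "e \<le> 2" "e \<le> \<epsilon>"
    using \<open>\<epsilon> > 0\<close> by (auto simp: e_def)
  then have "0 < e / 2 \<and> e / 2 \<le> 2"
    by auto
  then obtain \<delta> where \<delta>: "\<delta> > 0" "\<And>u v :: 'a. norm u = 1 \<Longrightarrow> norm v = 1 \<Longrightarrow> norm (u - v) \<ge> e / 2 \<Longrightarrow>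
      norm ((u + v) /\<^sub>R 2) \<le> 1 - \<delta>"
    using uc unfolding uniformly_convex_def by blast
  define \<eta> where "\<eta> = min (e / 4) (\<delta> / 2)"
  have \<eta>: "0 < \<eta>" "\<eta> \<le> e / 4" "\<eta> \<le> \<delta> / 2" "\<eta> < 1"
    using e \<delta>(1) by (auto simp: \<eta>_def)
  have "norm ((u + v) /\<^sub>R 2) \<le> 1 - \<eta> / 2"
    if uv: "norm u \<le> 1" "norm v \<le> 1" "norm (u - v) \<ge> \<epsilon>" for u v :: 'a
  proof (cases "norm u \<le> 1 - \<eta> \<or> norm v \<le> 1 - \<eta>")
    case True
    then show ?thesis
      using uv(1,2) norm_triangle_ineq[of u v] by auto
  next
    case False
    have near: "norm (w - sgn w) \<le> \<eta>" "norm (sgn w) = 1" if "norm w > 1 - \<eta>" "norm w \<le> 1" for w :: 'a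
    proof -
      have "w \<noteq> 0"
        using that \<eta>(4) by auto
      then show "norm (sgn w) = 1"
        by (simp add: norm_sgn)
      have "w - sgn w = (norm w - 1) *\<^sub>R sgn w"
        using \<open>w \<noteq> 0\<close> by (simp add: sgn_div_norm algebra_simps)
      then show "norm (w - sgn w) \<le> \<eta>"
        using that \<open>norm (sgn w) = 1\<close> by simp
    qed
    note u = near[of u] and v = near[of v]
    have "u - v = (sgn u - sgn v) + (u - sgn u) - (v - sgn v)"
      by simp
    then have "norm (u - v) \<le> norm (sgn u - sgn v) + norm (u - sgn u) + norm (v - sgn v)"
      by (metis norm_triangle_ineq norm_triangle_ineq4 add_right_mono order_trans)
    then have "norm (sgn u - sgn v) \<ge> e / 2"
      using u v uv False \<eta>(2) e(3) by auto
    then have "norm (sgn u + sgn v) \<le> 2 - 2 * \<delta>"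
      using \<delta>(2)[of "sgn u" "sgn v"] u v uv False by auto
    moreover have "u + v = (sgn u + sgn v) + (u - sgn u) + (v - sgn v)"
      by simp
    then have "norm (u + v) \<le> norm (sgn u + sgn v) + norm (u - sgn u) + norm (v - sgn v)"
      by (metis norm_triangle_ineq add_right_mono order_trans)
    ultimately have "norm (u + v) \<le> 2 - 2 * \<delta> + 2 * \<eta>"
      using u v uv False by auto
    then show ?thesis
      using \<eta> by auto
  qed
  then show ?thesis
    using \<eta> by (intro that[of "\<eta> / 2"]) auto
qed

text \<open>After scaling by \<open>\<omega> t / (s + \<eta>)\<close>, both \<open>x t - p\<close> and \<open>x t - q\<close> lie in the unit ball, and their
  distance is at least \<open>\<beta> * e / (2 * R)\<close> as long as \<open>\<eta> \<le> s \<le> R\<close>. The gain \<open>\<delta>\<close> thus depends on \<open>R\<close>, but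
  neither on \<open>t\<close> nor on \<open>s\<close>.\<close>

lemma midpoint_gains_degree:
  fixes x :: "nat \<Rightarrow> 'a::real_normed_vector"
  assumes uc: "uniformly_convex TYPE('a)" and I: "nat_ideal I"
    and \<beta>: "\<beta> > 0" "\<And>t. \<omega> t > \<beta>" and "e > 0" "R > 0"
  obtains \<delta> where "0 < \<delta>" "\<delta> < 1"
    "\<And>s p q. 0 < s \<Longrightarrow> s \<le> R \<Longrightarrow> p \<in> weighted_LIM \<omega> I s x \<Longrightarrow> q \<in> weighted_LIM \<omega> I s x \<Longrightarrow>
       norm (p - q) \<ge> e \<Longrightarrow> (p + q) /\<^sub>R 2 \<in> weighted_LIM \<omega> I ((1 - \<delta>) * s) x"
proof -
  define \<epsilon>0 where "\<epsilon>0 = \<beta> * e / (2 * R)"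
  have "\<epsilon>0 > 0"
    using assms by (simp add: \<epsilon>0_def)
  then obtain \<delta> where \<delta>: "0 < \<delta>" "\<delta> < 1"
    "\<And>u v :: 'a. norm u \<le> 1 \<Longrightarrow> norm v \<le> 1 \<Longrightarrow> norm (u - v) \<ge> \<epsilon>0 \<Longrightarrow> norm ((u + v) /\<^sub>R 2) \<le> 1 - \<delta>"
    using uniformly_convex_unit_ball[OF uc] by blast
  have "(p + q) /\<^sub>R 2 \<in> weighted_LIM \<omega> I ((1 - \<delta>) * s) x"
    if s: "0 < s" "s \<le> R" and p: "p \<in> weighted_LIM \<omega> I s x" and q: "q \<in> weighted_LIM \<omega> I s x"
      and pq: "norm (p - q) \<ge> e" for s p q
    unfolding weighted_LIM_iff[OF I]
  proof (intro allI impI)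
    fix \<epsilon> :: real assume "\<epsilon> > 0"
    define \<eta> where "\<eta> = min \<epsilon> s"
    have \<eta>: "0 < \<eta>" "\<eta> \<le> \<epsilon>" "\<eta> \<le> s"
      using \<open>\<epsilon> > 0\<close> s by (auto simp: \<eta>_def)
    obtain A where A: "A \<in> I" "\<And>t. t \<notin> A \<Longrightarrow> \<omega> t * norm (x t - p) \<le> s + \<eta>"
      "\<And>t. t \<notin> A \<Longrightarrow> \<omega> t * norm (x t - q) \<le> s + \<eta>"
      using weighted_LIM_two[OF I p q \<eta>(1)] by blast
    have "\<omega> t * norm (x t - (p + q) /\<^sub>R 2) \<le> (1 - \<delta>) * s + \<epsilon>" if "t \<notin> A" for t
    proof -
      define c where "c = \<omega> t / (s + \<eta>)"
      have \<omega>: "\<omega> t > 0"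
        using \<beta>(1) \<beta>(2)[of t] by linarith
      have c: "c > 0" "c * (s + \<eta>) = \<omega> t"
        using \<omega> s \<eta> by (auto simp: c_def)
      define u where "u = c *\<^sub>R (x t - p)"
      define v where "v = c *\<^sub>R (x t - q)"
      have "norm u \<le> 1" "norm v \<le> 1"
        using A(2,3)[OF that] s \<eta> \<omega> unfolding u_def v_def c_def by (simp_all add: pos_divide_le_eq)
      moreover have "norm (u - v) \<ge> \<epsilon>0"
      proof -
        have "\<epsilon>0 \<le> \<omega> t * norm (p - q) / (s + \<eta>)"
          unfolding \<epsilon>0_def using \<beta>(1) \<beta>(2)[of t] pq \<open>e > 0\<close> s \<eta>
          by (intro frac_le mult_mono) auto
        also have "\<dots> = c * norm (q - p)"
          by (simp add: c_def norm_minus_commute)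
        also have "q - p = (x t - p) - (x t - q)"
          by simp
        also have "c * norm \<dots> = norm (u - v)"
          unfolding u_def v_def scaleR_diff_right[symmetric] using c(1) by simp
        finally show ?thesis .
      qed
      ultimately have mid: "norm ((u + v) /\<^sub>R 2) \<le> 1 - \<delta>"
        by (rule \<delta>(3))
      have "x t - (p + q) /\<^sub>R 2 = ((x t - p) + (x t - q)) /\<^sub>R 2"
        by (simp add: algebra_simps flip: scaleR_left.add)
      then have "(u + v) /\<^sub>R 2 = c *\<^sub>R (x t - (p + q) /\<^sub>R 2)"
        by (simp add: u_def v_def flip: scaleR_right_distrib)
      then have "c * norm (x t - (p + q) /\<^sub>R 2) \<le> 1 - \<delta>"
        using mid c(1) by simp
      then have "(s + \<eta>) * (c * norm (x t - (p + q) /\<^sub>R 2)) \<le> (s + \<eta>) * (1 - \<delta>)"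
        using s \<eta> by (intro mult_left_mono) auto
      then have "\<omega> t * norm (x t - (p + q) /\<^sub>R 2) \<le> (s + \<eta>) * (1 - \<delta>)"
        unfolding mult.assoc[symmetric] mult.commute[of "s + \<eta>" c] c(2) .
      also have "\<dots> \<le> (1 - \<delta>) * s + \<epsilon>"
        using \<delta>(1) \<eta> by (simp add: algebra_simps add_increasing2)
      finally show ?thesis .
    qed
    then show "\<exists>A\<in>I. \<forall>t. t \<notin> A \<longrightarrow> \<omega> t * norm (x t - (p + q) /\<^sub>R 2) \<le> (1 - \<delta>) * s + \<epsilon>"
      using A(1) by blast
  qed
  then show ?thesis
    using \<delta> that by blast
qed

section \<open>Limits at the minimal degree\<close>

text \<open>For \<open>r > 0\<close> two distant limits of degree close to \<open>r\<close> would have a midpoint of degree below \<open>r\<close>.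
  For \<open>r = 0\<close> the bound comes from the triangle inequality at a single index off the exceptional set,
  which exists because the ideal is proper.\<close>

lemma small_diameter_near_min_degree:
  fixes x :: "nat \<Rightarrow> 'a::real_normed_vector"
  assumes uc: "uniformly_convex TYPE('a)" and I: "nat_ideal I" "UNIV \<notin> I"
    and \<beta>: "\<beta> > 0" "\<And>t. \<omega> t > \<beta>" and "r \<ge> 0" and r: "ereal r \<le> min_degree \<omega> I x" and "e > 0"
  obtains s where "s > r"
    "\<And>p q. p \<in> weighted_LIM \<omega> I s x \<Longrightarrow> q \<in> weighted_LIM \<omega> I s x \<Longrightarrow> norm (p - q) < e"
proof (cases "r = 0")
  case True
  define s where "s = \<beta> * e / 8"
  have "s > 0"
    using \<beta>(1) \<open>e > 0\<close> by (simp add: s_def)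
  have "norm (p - q) < e" if p: "p \<in> weighted_LIM \<omega> I s x" and q: "q \<in> weighted_LIM \<omega> I s x" for p q
  proof -
    obtain A where A: "A \<in> I" "\<And>t. t \<notin> A \<Longrightarrow> \<omega> t * norm (x t - p) \<le> s + s"
      "\<And>t. t \<notin> A \<Longrightarrow> \<omega> t * norm (x t - q) \<le> s + s"
      using weighted_LIM_two[OF I(1) p q \<open>s > 0\<close>] by blast
    obtain t where t: "t \<notin> A"
      using A(1) I(2) by (metis UNIV_eq_I)
    have "\<beta> * norm (p - q) \<le> \<omega> t * (norm (x t - q) + norm (x t - p))"
      using \<beta>(1) \<beta>(2)[of t] norm_triangle_ineq4[of "x t - q" "x t - p"] by (intro mult_mono) auto
    also have "\<dots> \<le> 4 * s"
      using A(2,3)[OF t] by (simp add: algebra_simps)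
    also have "\<dots> < \<beta> * e"
      using \<open>s > 0\<close> unfolding s_def by simp
    finally show ?thesis
      using \<beta>(1) by simp
  qed
  then show ?thesis
    using that \<open>s > 0\<close> True by blast
next
  case False
  then have "r > 0"
    using \<open>r \<ge> 0\<close> by simp
  then obtain \<delta> where \<delta>: "0 < \<delta>" "\<delta> < 1"
    "\<And>s p q. 0 < s \<Longrightarrow> s \<le> 2 * r \<Longrightarrow> p \<in> weighted_LIM \<omega> I s x \<Longrightarrow> q \<in> weighted_LIM \<omega> I s x \<Longrightarrow>
       norm (p - q) \<ge> e \<Longrightarrow> (p + q) /\<^sub>R 2 \<in> weighted_LIM \<omega> I ((1 - \<delta>) * s) x"
    using midpoint_gains_degree[where \<omega> = \<omega> and R = "2 * r" and x = x, OF uc I(1) \<beta> \<open>e > 0\<close>] by auto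
  \<comment> \<open>Chosen so that \<open>(1 - \<delta>) * s = (1 - \<delta>\<^sup>2) * r\<close>, which is below \<open>r\<close>.\<close>
  define s where "s = (1 + \<delta>) * r"
  have s: "r < s" "s \<le> 2 * r"
    using \<open>r > 0\<close> \<delta> by (auto simp: s_def)
  have "(1 - \<delta>) * s = r - \<delta> * \<delta> * r"
    by (simp add: s_def algebra_simps)
  then have low: "(1 - \<delta>) * s < r"
    using \<open>r > 0\<close> \<delta> by simp
  have "norm (p - q) < e" if "p \<in> weighted_LIM \<omega> I s x" "q \<in> weighted_LIM \<omega> I s x" for p q
  proof (rule ccontr)
    assume "\<not> norm (p - q) < e"
    then have "(p + q) /\<^sub>R 2 \<in> weighted_LIM \<omega> I ((1 - \<delta>) * s) x"
      using \<delta>(3)[of s p q] that s \<open>r > 0\<close> by simp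
    moreover have "(1 - \<delta>) * s > 0"
      using \<delta> s \<open>r > 0\<close> by simp
    ultimately have "min_degree \<omega> I x \<le> ereal ((1 - \<delta>) * s)"
      using min_degree_le by blast
    then have "ereal r \<le> ereal ((1 - \<delta>) * s)"
      using r order_trans by blast
    then show False
      using low by simp
  qed
  then show ?thesis
    using that s by blast
qed

lemma unique_limit_at_min_degree:
  fixes x :: "nat \<Rightarrow> 'a::real_normed_vector"
  assumes uc: "uniformly_convex TYPE('a)" and I: "nat_ideal I" "UNIV \<notin> I"
    and \<beta>: "\<beta> > 0" "\<And>t. \<omega> t > \<beta>" and "r \<ge> 0" and r: "ereal r \<le> min_degree \<omega> I x"
    and p: "p \<in> weighted_LIM \<omega> I r x" and q: "q \<in> weighted_LIM \<omega> I r x"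
  shows "p = q"
proof (rule ccontr)
  assume "p \<noteq> q"
  then obtain s where "s > r" "\<And>p' q'. p' \<in> weighted_LIM \<omega> I s x \<Longrightarrow> q' \<in> weighted_LIM \<omega> I s x \<Longrightarrow>
      norm (p' - q') < norm (p - q)"
    using small_diameter_near_min_degree[OF uc I \<beta> \<open>r \<ge> 0\<close> r, of "norm (p - q)"] by auto
  then show False
    using p q weighted_LIM_mono[OF I(1), of r s] by (meson less_imp_le less_irrefl subsetD)
qed

text \<open>Limits of degrees decreasing to \<open>r\<close> form a Cauchy sequence. If it is not constant, two of its
  terms bound the weights, and then the limit of the sequence inherits the degree \<open>r\<close>.\<close>

lemma limit_exists_at_min_degree:
  fixes x :: "nat \<Rightarrow> 'a::banach"
  assumes uc: "uniformly_convex TYPE('a)" and I: "nat_ideal I" "UNIV \<notin> I"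
    and \<beta>: "\<beta> > 0" "\<And>t. \<omega> t > \<beta>" and "r \<ge> 0" and r: "ereal r = min_degree \<omega> I x"
  shows "weighted_LIM \<omega> I r x \<noteq> {}"
proof -
  have pos: "\<omega> t > 0" for t
    using \<beta>(1) \<beta>(2)[of t] by linarith
  define a where "a n = r + 1 / real (Suc n)" for n
  have "\<exists>p. p \<in> weighted_LIM \<omega> I (a n) x" for n
  proof -
    have "min_degree \<omega> I x < ereal (a n)"
      using r[symmetric] by (simp add: a_def)
    then show ?thesis
      using weighted_LIM_nonempty_above[OF I(1)] by blast
  qed
  then obtain p where p: "\<And>n. p n \<in> weighted_LIM \<omega> I (a n) x"
    by metis
  have eventually_in: "\<exists>N. \<forall>n\<ge>N. p n \<in> weighted_LIM \<omega> I s x" if "s > r" for s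
  proof -
    have "s - r > 0"
      using that by simp
    then obtain N where N: "1 / real (Suc N) < s - r"
      by (rule nat_approx_posE)
    have "a n \<le> s" if "n \<ge> N" for n
    proof -
      have "1 / real (Suc n) \<le> 1 / real (Suc N)"
        using that by (intro divide_left_mono) auto
      then show ?thesis
        using N unfolding a_def by linarith
    qed
    then show ?thesis
      using p weighted_LIM_mono[OF I(1)] by (meson subsetD)
  qed
  show ?thesis
  proof (cases "\<forall>n. p n = p 0")
    case True
    have "p 0 \<in> weighted_LIM \<omega> I s x" if "s > r" for s
      using eventually_in[OF that] True by (metis order_refl)
    then show ?thesis
      using weighted_LIM_right_continuous[OF I(1)] by blast
  next
    case False
    then obtain n where n: "p n \<noteq> p 0"
      by blast
    have "p m \<in> weighted_LIM \<omega> I (r + 1) x" for m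
      using p[of m] weighted_LIM_mono[OF I(1), of "a m" "r + 1"] by (auto simp: a_def)
    then have "ideal_bounded I \<omega>"
      using two_limits_bound_weights[where \<omega> = \<omega> and x = x and s = "r + 1", OF I(1) pos _ _ _ n]
        \<open>r \<ge> 0\<close> by simp
    then obtain \<mu> where \<mu>: "\<mu> > 0" "{t. \<omega> t > \<mu>} \<in> I"
      unfolding ideal_bounded_def by blast
    have "Cauchy p"
    proof (rule CauchyI)
      fix e :: real assume "e > 0"
      then obtain s where "s > r" and
        s: "\<And>u v. u \<in> weighted_LIM \<omega> I s x \<Longrightarrow> v \<in> weighted_LIM \<omega> I s x \<Longrightarrow> norm (u - v) < e"
        using small_diameter_near_min_degree[where \<omega> = \<omega>, OF uc I \<beta> \<open>r \<ge> 0\<close>] r by (metis order_refl)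
      then show "\<exists>M. \<forall>m\<ge>M. \<forall>n\<ge>M. norm (p m - p n) < e"
        using eventually_in by meson
    qed
    then obtain l where l: "p \<longlonglongrightarrow> l"
      using Cauchy_convergent convergent_def by blast
    have "l \<in> weighted_LIM \<omega> I s x" if "s > r" for s
    proof -
      define d where "d = (s - r) / 2"
      have d: "d > 0" "r + d > r" "r + d + d = s"
        using that by (auto simp: d_def)
      obtain N where N: "\<forall>n\<ge>N. p n \<in> weighted_LIM \<omega> I (r + d) x"
        using eventually_in d(2) by blast
      obtain M where M: "\<forall>n\<ge>M. norm (p n - l) < d / \<mu>"
        using LIMSEQ_D[OF l, of "d / \<mu>"] d \<mu>(1) by auto
      have "\<mu> * norm (p (max M N) - l) \<le> d"
        using M[rule_format, of "max M N"] \<mu>(1) by (simp add: field_simps)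
      from weighted_LIM_shift[OF I(1) pos \<mu>(2) _ this, of "r + d" x]
      show ?thesis
        using N d(3) by simp
    qed
    then show ?thesis
      using weighted_LIM_right_continuous[OF I(1)] by blast
  qed
qed

theorem theorem3p8:
  fixes r :: real and I :: "nat set set" and \<omega> :: "nat \<Rightarrow> real" and x :: "nat \<Rightarrow> 'a::banach"
  assumes "r \<ge> 0"
    and "uniformly_convex TYPE('a)"
    and "nat_ideal I"
    and "weighted_seq \<omega>"
  shows "((\<exists>v::'a. v \<noteq> 0) \<longrightarrow>
            is_singleton (weighted_LIM \<omega> I r x) \<and> ideal_bounded I \<omega> \<longrightarrow>
            ereal r = min_degree \<omega> I x)
       \<and> (UNIV \<notin> I \<longrightarrow>
            ereal r = min_degree \<omega> I x \<and> P_ideal I \<longrightarrow>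
            is_singleton (weighted_LIM \<omega> I r x))"
proof (intro conjI impI)
  obtain \<beta> where \<beta>: "\<beta> > 0" "\<And>t. \<omega> t > \<beta>"
    using assms(4) unfolding weighted_seq_def by blast
  then have pos: "\<omega> t > 0" for t
    using less_trans by blast
  {
    assume "\<exists>v::'a. v \<noteq> 0" and "is_singleton (weighted_LIM \<omega> I r x) \<and> ideal_bounded I \<omega>"
    then obtain v :: 'a where "v \<noteq> 0" "is_singleton (weighted_LIM \<omega> I r x)" "ideal_bounded I \<omega>"
      by blast
    from singleton_imp_min_degree[OF assms(3,1) pos this] show "ereal r = min_degree \<omega> I x"
      by (rule sym)
  next
    assume I: "UNIV \<notin> I" and "ereal r = min_degree \<omega> I x \<and> P_ideal I"
    then have r: "ereal r = min_degree \<omega> I x"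
      by blast
    show "is_singleton (weighted_LIM \<omega> I r x)"
    proof (rule is_singletonI')
      show "weighted_LIM \<omega> I r x \<noteq> {}"
        by (rule limit_exists_at_min_degree[OF assms(2,3) I \<beta> assms(1) r])
      show "p = q" if "p \<in> weighted_LIM \<omega> I r x" "q \<in> weighted_LIM \<omega> I r x" for p q
        using unique_limit_at_min_degree[where \<omega> = \<omega>, OF assms(2,3) I \<beta> assms(1) _ that] r by simp
    qed
  }
qed

end
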